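(* Let $\mathcal{M}\subseteq\mathcal{E}$ be a smooth embedded Riemannian submanifold of a Euclidean space $\mathcal{E}$ with retraction $\mathrm{R}:T\mathcal{M}\to\mathcal{M}$, and let $\varphi:\mathcal{M}\to\mathbb{R}$ be continuous. Assume that $\partial_{\mathcal{M}}\varphi$ is locally bounded and that for all $\bar x\in\mathcal{M}$ there exist $\tilde\kappa>0$, $r>0$ and an open neighborhood $V\subseteq\mathcal{M}$ of $\bar x$ with $$\varphi(\mathrm{R}_x(\xi_x))-\big(\varphi(x)+\langle w,\xi_x\rangle\big)\le\tilde\kappa\|\xi_x\|^2$$ for all $x\in V$, all $\xi_x\in T_x\mathcal{M}$ with $\|\xi_x\|\le r$ and all $w\in\partial_{\mathcal{M}}\varphi(x)$. Let $\{x^k\}$ be an infinite sequence generated by the nonmonotone subgradient method (described in the context), where for constants $a,b>0$ independent of $k$ one has $\langle w^k_{\mathcal{M}},d^k\rangle\le-a\|d^k\|^2$ and $\|w^k_{\mathcal{M}}\|\le b\|d^k\|$ for all $k$. Let $\{x^k\}_{k\in K}$ be a subsequence converging to some accumulation point $x^*\in\mathcal{M}$, and suppose that $\Phi:=\varphi+\delta_{\mathcal{M}}$ satisfies the Kurdyka–Łojasiewicz property at $x^*$. Then the entire sequence $\{x^k\}$ converges to $x^*$.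
   Context: $\mathcal{E}$ is a Euclidean space (finite-dimensional real Hilbert space) with inner product $\langle\cdot,\cdot\rangle$ and norm $\|\cdot\|$; $\overline{\mathbb{R}}=(-\infty,+\infty]$; $\mathrm{dist}(x,S)=\inf_{y\in S}\|x-y\|$. Smooth embedded submanifold: $\mathcal{M}\subseteq\mathcal{E}$ such that around each $\bar x\in\mathcal{M}$ there are an open neighborhood $U\subseteq\mathcal{E}$ and a $\mathcal{C}^1$ map $F:U\to\mathbb{R}^m$ with $\nabla F(\bar x)$ of rank $m$ ($m=\dim\mathcal{E}-\dim\mathcal{M}$) and $\mathcal{M}\cap U=\{x\in U:F(x)=0\}$. $T_x\mathcal{M}=\ker DF(x)\subseteq\mathcal{E}$ carries the inner product inherited from $\mathcal{E}$; $T\mathcal{M}=\{(x,\xi):x\in\mathcal{M},\xi\in T_x\mathcal{M}\}$. Retraction: a map $\mathrm{R}:T\mathcal{M}\to\mathcal{M}$, globally defined and at least $\mathcal{C}^2$ (locally the restriction of a $\mathcal{C}^2$ map on an open subset of $\mathcal{E}\times\mathcal{E}$), such that $\mathrm{R}_x:=\mathrm{R}(x,\cdot)$ satisfies $\mathrm{R}_x(0_x)=x$ and $D\mathrm{R}_x(0_x)=\mathrm{id}_{T_x\mathcal{M}}$ for all $x\in\mathcal{M}$. Subdifferentials: for $g:\mathcal{E}\to\overline{\mathbb{R}}$ and $g(x)<\infty$, $\hat\partial g(x)=\{v:\liminf_{y\to x,y\ne x}\frac{g(y)-g(x)-\langle v,y-x\rangle}{\|y-x\|}\ge0\}$, and the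 limiting subdifferential $\partial g(x)$ is the set of limits $v=\lim v^k$ with $v^k\in\hat\partial g(x^k)$, $x^k\to x$, $g(x^k)\to g(x)$. With $\delta_{\mathcal{M}}$ the indicator function of $\mathcal{M}$, $\Phi=\varphi+\delta_{\mathcal{M}}:\mathcal{E}\to\overline{\mathbb{R}}$ equals $\varphi$ on $\mathcal{M}$ and $+\infty$ elsewhere, and the projectional subdifferential is $\partial_{\mathcal{M}}\varphi(x)=\mathrm{proj}_{T_x\mathcal{M}}\partial\Phi(x)=\partial\Phi(x)\cap T_x\mathcal{M}$ for $x\in\mathcal{M}$. It is locally bounded if each point of $\mathcal{M}$ has a neighborhood $V$ in $\mathcal{M}$ with $\bigcup_{x\in V}\partial_{\mathcal{M}}\varphi(x)$ bounded. Kurdyka–Łojasiewicz (KL) property: a lower semicontinuous $g:\mathcal{E}\to\overline{\mathbb{R}}$ satisfies the KL property at $x^*$ with $\partial g(x^* )\ne\emptyset$ if there are $\eta>0$, a neighborhood $U\subset\mathcal{E}$ of $x^*$ and a continuous concave function $\chi:[0,\eta]\to[0,\infty)$ (desingularization function), continuously differentiable on $(0,\eta)$ with $\chi(0)=0$ and $\chi'(t)>0$ on $(0,\eta)$, such that $\chi'(g(x)-g(x^* ))\,\mathrm{dist}(0,\partial g(x))\ge1$ for all $x\in U$ with $g(x^* )<g(x)<g(x^* )+\eta$. Nonmonotone subgradient method. Parameters: $x^0\in\mathcal{M}$, $0<\tau_{\min}\le\tau_{\max}<\infty$, $\sigma,\beta\in(0,1)$, $p_{\min}\in(0,1]$. Set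 $\mathcal{R}_0:=\varphi(x^0)$. For $k=0,1,2,\dots$: choose $w^k_{\mathcal{M}}\in\partial_{\mathcal{M}}\varphi(x^k)$; if $w^k_{\mathcal{M}}=0$, stop and return $x^k$. Otherwise choose $d^k\in T_{x^k}\mathcal{M}\setminus\{0\}$ satisfying $\langle w^k_{\mathcal{M}},d^k\rangle\le-a\|d^k\|^2$ and $\|w^k_{\mathcal{M}}\|\le b\|d^k\|$. Choose an initial $\tau_k\in[\tau_{\min},\tau_{\max}]$; while $\varphi(\mathrm{R}_{x^k}(\tau_kd^k))>\mathcal{R}_k+\sigma\tau_k\langle w^k_{\mathcal{M}},d^k\rangle$, replace $\tau_k$ by $\beta\tau_k$. With the accepted $\tau_k$ set $x^{k+1}:=\mathrm{R}_{x^k}(\tau_kd^k)$. Choose $p_{k+1}\in[p_{\min},1]$ and set $\mathcal{R}_{k+1}:=(1-p_{k+1})\mathcal{R}_k+p_{k+1}\varphi(x^{k+1})$. *)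

theory Defs
  imports "HOL-Analysis.Analysis"
begin

subsection \<open>Smooth maps on open sets\<close>

definition C1_map_on :: "('a::real_normed_vector \<Rightarrow> 'b::real_normed_vector) \<Rightarrow> 'a set \<Rightarrow> bool" where
  "C1_map_on f U \<longleftrightarrow> (\<exists>f' :: 'a \<Rightarrow> 'a \<Rightarrow>\<^sub>L 'b.
     (\<forall>x\<in>U. (f has_derivative blinfun_apply (f' x)) (at x)) \<and> continuous_on U f')"

definition C2_map_on :: "('a::real_normed_vector \<Rightarrow> 'b::real_normed_vector) \<Rightarrow> 'a set \<Rightarrow> bool" where
  "C2_map_on f U \<longleftrightarrow> (\<exists>f' :: 'a \<Rightarrow> 'a \<Rightarrow>\<^sub>L 'b.
     (\<forall>x\<in>U. (f has_derivative blinfun_apply (f' x)) (at x)) \<and> C1_map_on f' U)"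

subsection \<open>Embedded submanifolds, tangent spaces, retractions\<close>

text \<open>A map from \<open>U\<close> to \<open>\<real>\<^sup>m\<close> is given by its components \<open>F 0, \<dots>, F (m - 1)\<close>, with gradients
  \<open>G 0, \<dots>, G (m - 1)\<close>. The rank of its derivative at \<open>x\<close> is the dimension of the span of the
  gradients at \<open>x\<close>; note that \<open>dim A\<close> is the dimension of the span of \<open>A\<close>.\<close>

definition local_defining_map ::
  "'a::euclidean_space set \<Rightarrow> nat \<Rightarrow> 'a \<Rightarrow> 'a set \<Rightarrow> (nat \<Rightarrow> 'a \<Rightarrow> real) \<Rightarrow> (nat \<Rightarrow> 'a \<Rightarrow> 'a) \<Rightarrow> bool" where
  "local_defining_map M m x U F G \<longleftrightarrow>
     open U \<and> x \<in> U \<and>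
     (\<forall>i<m. (\<forall>y\<in>U. GDERIV (F i) y :> G i y) \<and> continuous_on U (G i)) \<and>
     dim ((\<lambda>i. G i x) ` {..<m}) = m \<and>
     M \<inter> U = {y \<in> U. \<forall>i<m. F i y = 0}"

definition embedded_submanifold :: "'a::euclidean_space set \<Rightarrow> bool" where
  "embedded_submanifold M \<longleftrightarrow> (\<exists>m. \<forall>x\<in>M. \<exists>U F G. local_defining_map M m x U F G)"

definition tangent_space :: "'a::euclidean_space set \<Rightarrow> 'a \<Rightarrow> 'a set" where
  "tangent_space M x =
     {\<xi>. x \<in> M \<and> (\<exists>m U F G. local_defining_map M m x U F G \<and> (\<forall>i<m. G i x \<bullet> \<xi> = 0))}"

definition tangent_bundle :: "'a::euclidean_space set \<Rightarrow> ('a \<times> 'a) set" where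
  "tangent_bundle M = {(x, \<xi>). x \<in> M \<and> \<xi> \<in> tangent_space M x}"

text \<open>The kernel of the derivative does not depend on the local defining map.\<close>

lemma local_defining_kernel_subset:
  fixes M :: "'a::euclidean_space set"
  assumes x: "x \<in> M"
    and FG: "local_defining_map M m x U F G"
    and FG': "local_defining_map M m' x U' F' G'"
    and \<xi>: "\<forall>i<m. G i x \<bullet> \<xi> = 0" and j: "j < m'"
  shows "G' j x \<bullet> \<xi> = 0"
proof -
  define g where "g i = G i x" for i
  have U: "open U" "x \<in> U" and dF: "\<And>i y. i < m \<Longrightarrow> y \<in> U \<Longrightarrow> GDERIV (F i) y :> G i y"
    and cG: "\<And>i. i < m \<Longrightarrow> continuous_on U (G i)"
    and dm: "dim (g ` {..<m}) = m"
    and MU: "M \<inter> U = {y \<in> U. \<forall>i<m. F i y = 0}"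
    using FG by (auto simp: local_defining_map_def g_def)
  have U': "open U'" "x \<in> U'" and dF': "GDERIV (F' j) x :> G' j x"
    and MU': "M \<inter> U' = {y \<in> U'. \<forall>i<m'. F' i y = 0}"
    using FG' j by (auto simp: local_defining_map_def)
  have cardg: "card (g ` {..<m}) = m"
    using dim_le_card'[of "g ` {..<m}"] card_image_le[of "{..<m}" g] dm by simp
  have inj: "inj_on g {..<m}"
    using cardg by (intro eq_card_imp_inj_on) auto
  have indep: "independent (g ` {..<m})"
    using card_le_dim_spanning[of "g ` {..<m}" "g ` {..<m}"] cardg dm by (simp add: span_superset)
  have "\<exists>e. \<forall>k<m. g k \<bullet> e = (if k = i then 1 else 0)" if "i < m" for i
  proof -
    obtain f :: "'a \<Rightarrow> real" where f: "linear f"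
      "\<forall>y\<in>g ` {..<m}. f y = (if y = g i then 1 else 0)"
      using linear_independent_extend[OF indep, of "\<lambda>y. if y = g i then 1 else (0::real)"] by blast
    have "g k \<bullet> adjoint f 1 = (if k = i then 1 else 0)" if "k < m" for k
    proof -
      have "g k \<bullet> adjoint f 1 = f (g k)" using adjoint_works[OF f(1), of "g k" 1] by simp
      also have "\<dots> = (if g k = g i then 1 else 0)" using f(2) that by blast
      also have "g k = g i \<longleftrightarrow> k = i"
        using inj_on_eq_iff[OF inj, of k i] that \<open>i < m\<close> by simp
      finally show ?thesis .
    qed
    then show ?thesis by blast
  qed
  then have "\<forall>i\<in>{..<m}. \<exists>e. \<forall>k<m. g k \<bullet> e = (if k = i then 1 else 0)" by simp
  then obtain e where "\<forall>i\<in>{..<m}. \<forall>k<m. g k \<bullet> e i = (if k = i then 1 else 0)"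
    by (rule bchoice[THEN exE])
  then have e: "g k \<bullet> e i = (if k = i then 1 else 0)" if "i < m" "k < m" for i k
    using that by simp
  define H where "H y = (y - x) + (\<Sum>i<m. (F i y - g i \<bullet> (y - x)) *\<^sub>R e i)" for y
  define H' where "H' y = id_blinfun +
    (\<Sum>i<m. blinfun_scaleR_left (e i) o\<^sub>L blinfun_inner_left (G i y - g i))" for y
  have gH: "g k \<bullet> H y = F k y" if "k < m" for k y
  proof -
    have "g k \<bullet> H y = g k \<bullet> (y - x) + (\<Sum>i<m. (F i y - g i \<bullet> (y - x)) * (if k = i then 1 else 0))"
      using that by (simp add: H_def inner_add_right inner_sum_right e)
    also have "(\<Sum>i<m. (F i y - g i \<bullet> (y - x)) * (if k = i then 1 else 0)) =
        (\<Sum>i<m. if k = i then F i y - g i \<bullet> (y - x) else 0)"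
      by (intro sum.cong) auto
    also have "g k \<bullet> (y - x) + \<dots> = F k y" using that by (simp add: sum.delta')
    finally show ?thesis .
  qed
  have derH: "(H has_derivative blinfun_apply (H' y)) (at y)" if "y \<in> U" for y
  proof -
    have 1: "(F i has_derivative (\<lambda>h. h \<bullet> G i y)) (at y)" if "i < m" for i
      using dF[OF that \<open>y \<in> U\<close>] by (simp add: gderiv_def)
    have "(H has_derivative (\<lambda>h. (h - 0) + (\<Sum>i<m. (h \<bullet> G i y - g i \<bullet> (h - 0)) *\<^sub>R e i))) (at y)"
      unfolding H_def
      by (intro has_derivative_add has_derivative_diff has_derivative_sum has_derivative_scaleR_left
          has_derivative_inner_right has_derivative_ident has_derivative_const 1) auto
    moreover have "(\<lambda>h. (h - 0) + (\<Sum>i<m. (h \<bullet> G i y - g i \<bullet> (h - 0)) *\<^sub>R e i)) = blinfun_apply (H' y)"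
      by (simp add: H'_def blinfun.add_left blinfun.sum_left fun_eq_iff inner_diff_right inner_commute)
    ultimately show ?thesis by simp
  qed
  have contH: "continuous_on U H'"
    unfolding H'_def
    by (intro continuous_intros bounded_linear.continuous_on[OF bounded_linear_blinfun_inner_left] cG) auto
  have H'x: "H' x = id_blinfun"
    by (rule blinfun_eqI) (simp add: H'_def g_def blinfun.add_left blinfun.sum_left)
  have Fx: "F i x = 0" if "i < m" for i using MU x U that by blast
  have Hx: "H x = 0" by (simp add: H_def Fx)
  obtain V1 V c c' where V: "open V1" "V1 \<subseteq> U" "x \<in> V1" "open V" "H x \<in> V"
      and hom: "homeomorphism V1 V H c"
      and dc: "\<And>y. y \<in> V \<Longrightarrow> (c has_derivative (c' y)) (at y)"
      and c': "\<And>y. y \<in> V \<Longrightarrow> c' y = inv (blinfun_apply (H' (c y)))"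
    by (rule inverse_function_theorem[OF U(1) derH contH U(2), of id_blinfun])
      (auto simp: H'x intro: blinfun_eqI)
  have c0: "c 0 = x" using homeomorphism_apply1[OF hom V(3)] Hx by simp
  have V0: "0 \<in> V" using V Hx by simp
  have "c' 0 = id" using c'[OF V0] by (simp add: c0 H'x id_def[symmetric] inv_id)
  then have dc0: "(c has_derivative id) (at 0)" using dc[OF V0] by simp
  have "((\<lambda>t::real. t *\<^sub>R \<xi>) has_derivative (\<lambda>t. t *\<^sub>R \<xi>)) (at 0)"
    by (rule derivative_eq_intros refl | simp)+
  then have dcur: "((\<lambda>t::real. c (t *\<^sub>R \<xi>)) has_derivative (\<lambda>t. t *\<^sub>R \<xi>)) (at 0)"
    using has_derivative_compose[of "\<lambda>t::real. t *\<^sub>R \<xi>" _ 0 UNIV c id] dc0 by simp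
  have cont: "isCont (\<lambda>t::real. c (t *\<^sub>R \<xi>)) 0"
    using dcur has_derivative_continuous by blast
  have cont2: "isCont (\<lambda>t::real. t *\<^sub>R \<xi>) 0" by (intro continuous_intros)
  have ev1: "\<forall>\<^sub>F t::real in at 0. t *\<^sub>R \<xi> \<in> V"
    using cont2 V(4) V0 unfolding isCont_def by (intro topological_tendstoD) auto
  have ev2: "\<forall>\<^sub>F t::real in at 0. c (t *\<^sub>R \<xi>) \<in> U'"
    using cont U' c0 unfolding isCont_def by (intro topological_tendstoD) auto
  have "\<forall>\<^sub>F t::real in at 0. F' j (c (t *\<^sub>R \<xi>)) = 0"
    using ev1 ev2
  proof eventually_elim
    case (elim t)
    have "c (t *\<^sub>R \<xi>) \<in> U"
      using elim(1) hom V(2) by (auto simp: homeomorphism_def)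
    moreover have "F k (c (t *\<^sub>R \<xi>)) = 0" if "k < m" for k
      using gH[OF that, of "c (t *\<^sub>R \<xi>)"] homeomorphism_apply2[OF hom elim(1)] \<xi> that
      by (simp add: g_def)
    ultimately have "c (t *\<^sub>R \<xi>) \<in> M" using MU by blast
    then show ?case using elim(2) MU' j by blast
  qed
  moreover have F'x: "F' j x = 0" using MU' x U' j by blast
  ultimately have z: "((\<lambda>t::real. F' j (c (t *\<^sub>R \<xi>))) has_derivative (\<lambda>t. 0)) (at 0)"
  proof -
    assume ev: "\<forall>\<^sub>F t::real in at 0. F' j (c (t *\<^sub>R \<xi>)) = 0"
    show ?thesis
    proof (rule has_derivative_transform_eventually[of "\<lambda>_. 0"])
      show "\<forall>\<^sub>F t::real in at 0. 0 = F' j (c (t *\<^sub>R \<xi>))"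
        using ev by eventually_elim (rule sym)
    qed (simp_all add: c0 F'x)
  qed
  have "((\<lambda>t::real. F' j (c (t *\<^sub>R \<xi>))) has_derivative (\<lambda>t. (t *\<^sub>R \<xi>) \<bullet> G' j x)) (at 0)"
    using has_derivative_compose[OF dcur, of "F' j" "\<lambda>h. h \<bullet> G' j x"] dF' c0
    by (simp add: gderiv_def)
  from has_derivative_unique[OF z this] have "0 = (1 *\<^sub>R \<xi>) \<bullet> G' j x" by (rule fun_cong)
  then show ?thesis by (simp add: inner_commute)
qed

lemma tangent_space_eq_kernel:
  assumes "x \<in> M" "local_defining_map M m x U F G"
  shows "tangent_space M x = {\<xi>. \<forall>i<m. G i x \<bullet> \<xi> = 0}"
  using assms local_defining_kernel_subset[OF assms(1) _ assms(2)]
  unfolding tangent_space_def by blast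

definition retraction_on :: "'a::euclidean_space set \<Rightarrow> ('a \<Rightarrow> 'a \<Rightarrow> 'a) \<Rightarrow> bool" where
  "retraction_on M R \<longleftrightarrow>
     (\<forall>(x, \<xi>) \<in> tangent_bundle M. R x \<xi> \<in> M) \<and>
     (\<forall>p \<in> tangent_bundle M. \<exists>W f. open W \<and> p \<in> W \<and> C2_map_on f W \<and>
        (\<forall>(y, \<eta>) \<in> W \<inter> tangent_bundle M. R y \<eta> = f (y, \<eta>))) \<and>
     (\<forall>x\<in>M. R x 0 = x \<and> (R x has_derivative (\<lambda>\<xi>. \<xi>)) (at 0 within tangent_space M x))"

subsection \<open>Subdifferentials\<close>

text \<open>Functions into the extended reals without \<open>-\<infinity>\<close> have type \<open>'a \<Rightarrow> ereal\<close>.\<close>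

definition frechet_subdiff :: "('a::euclidean_space \<Rightarrow> ereal) \<Rightarrow> 'a \<Rightarrow> 'a set" where
  "frechet_subdiff g x = {v. \<bar>g x\<bar> \<noteq> \<infinity> \<and>
     Liminf (at x) (\<lambda>y. (g y - g x - ereal (v \<bullet> (y - x))) / ereal (norm (y - x))) \<ge> 0}"

definition limiting_subdiff :: "('a::euclidean_space \<Rightarrow> ereal) \<Rightarrow> 'a \<Rightarrow> 'a set" where
  "limiting_subdiff g x = {v. \<bar>g x\<bar> \<noteq> \<infinity> \<and>
     (\<exists>xs vs. (\<forall>k. vs k \<in> frechet_subdiff g (xs k)) \<and>
        xs \<longlonglongrightarrow> x \<and> (\<lambda>k. g (xs k)) \<longlonglongrightarrow> g x \<and> vs \<longlonglongrightarrow> v)}"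

definition indicator_fun :: "'a set \<Rightarrow> 'a \<Rightarrow> ereal" where
  "indicator_fun M x = (if x \<in> M then 0 else \<infinity>)"

definition extended_fun :: "'a set \<Rightarrow> ('a \<Rightarrow> real) \<Rightarrow> 'a \<Rightarrow> ereal" where
  "extended_fun M \<phi> x = ereal (\<phi> x) + indicator_fun M x"

text \<open>\<open>closest_point\<close> onto the linear subspace \<open>tangent_space M x\<close> is the orthogonal projection.\<close>

definition proj_subdiff :: "'a::euclidean_space set \<Rightarrow> ('a \<Rightarrow> real) \<Rightarrow> 'a \<Rightarrow> 'a set" where
  "proj_subdiff M \<phi> x = closest_point (tangent_space M x) ` limiting_subdiff (extended_fun M \<phi>) x"

definition locally_bounded_on :: "'a::euclidean_space set \<Rightarrow> ('a \<Rightarrow> 'a set) \<Rightarrow> bool" where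
  "locally_bounded_on M A \<longleftrightarrow>
     (\<forall>x\<in>M. \<exists>V. openin (top_of_set M) V \<and> x \<in> V \<and> bounded (\<Union>y\<in>V. A y))"

subsection \<open>Kurdyka--Lojasiewicz property\<close>

definition lower_semicontinuous :: "('a::topological_space \<Rightarrow> ereal) \<Rightarrow> bool" where
  "lower_semicontinuous g \<longleftrightarrow> (\<forall>x. g x \<le> Liminf (at x) g)"

text \<open>The distance to the empty set is \<open>\<infinity>\<close>, whereas \<open>infdist x {} = 0\<close>.\<close>

definition ext_dist :: "'a::metric_space \<Rightarrow> 'a set \<Rightarrow> ereal" where
  "ext_dist x S = (INF y\<in>S. ereal (dist x y))"

definition desingularization :: "real \<Rightarrow> (real \<Rightarrow> real) \<Rightarrow> (real \<Rightarrow> real) \<Rightarrow> bool" where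
  "desingularization \<eta> \<psi> \<psi>' \<longleftrightarrow>
     continuous_on {0..\<eta>} \<psi> \<and> concave_on {0..\<eta>} \<psi> \<and> (\<forall>t\<in>{0..\<eta>}. 0 \<le> \<psi> t) \<and> \<psi> 0 = 0 \<and>
     (\<forall>t\<in>{0<..<\<eta>}. (\<psi> has_real_derivative \<psi>' t) (at t) \<and> 0 < \<psi>' t) \<and>
     continuous_on {0<..<\<eta>} \<psi>'"

definition KL_property :: "('a::euclidean_space \<Rightarrow> ereal) \<Rightarrow> 'a \<Rightarrow> bool" where
  "KL_property g z \<longleftrightarrow> lower_semicontinuous g \<and> limiting_subdiff g z \<noteq> {} \<and>
     (\<exists>\<eta>>0. \<exists>U \<psi> \<psi>'. open U \<and> z \<in> U \<and> desingularization \<eta> \<psi> \<psi>' \<and>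
        (\<forall>x\<in>U. g z < g x \<and> g x < g z + ereal \<eta> \<longrightarrow>
           ereal (\<psi>' (real_of_ereal (g x - g z))) * ext_dist 0 (limiting_subdiff g x) \<ge> 1))"

subsection \<open>Nonmonotone subgradient method\<close>

definition sufficient_decrease ::
  "('a::euclidean_space \<Rightarrow> 'a \<Rightarrow> 'a) \<Rightarrow> ('a \<Rightarrow> real) \<Rightarrow> real \<Rightarrow> real \<Rightarrow> 'a \<Rightarrow> 'a \<Rightarrow> 'a \<Rightarrow> real \<Rightarrow> bool" where
  "sufficient_decrease R \<phi> \<sigma> r x w d t \<longleftrightarrow> \<phi> (R x (t *\<^sub>R d)) \<le> r + \<sigma> * t * (w \<bullet> d)"

text \<open>An infinite run, i.e. the stopping test never succeeds. \<open>\<tau> k\<close> is the accepted stepsize: the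
  first element of the backtracking sequence \<open>t, \<beta> t, \<beta>\<^sup>2 t, \<dots>\<close> that yields sufficient decrease,
  where \<open>t\<close> is the initial trial stepsize.\<close>

definition infinite_run ::
  "'a::euclidean_space set \<Rightarrow> ('a \<Rightarrow> 'a \<Rightarrow> 'a) \<Rightarrow> ('a \<Rightarrow> real) \<Rightarrow>
   real \<Rightarrow> real \<Rightarrow> real \<Rightarrow> real \<Rightarrow> real \<Rightarrow> real \<Rightarrow> real \<Rightarrow>
   (nat \<Rightarrow> 'a) \<Rightarrow> (nat \<Rightarrow> 'a) \<Rightarrow> (nat \<Rightarrow> 'a) \<Rightarrow> (nat \<Rightarrow> real) \<Rightarrow> (nat \<Rightarrow> real) \<Rightarrow> (nat \<Rightarrow> real) \<Rightarrow> bool" where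
  "infinite_run M R \<phi> \<tau>min \<tau>max \<sigma> \<beta> pmin a b x w d \<tau> p \<R> \<longleftrightarrow>
     x 0 \<in> M \<and> \<R> 0 = \<phi> (x 0) \<and>
     (\<forall>k.
        w k \<in> proj_subdiff M \<phi> (x k) \<and> w k \<noteq> 0 \<and>
        d k \<in> tangent_space M (x k) - {0} \<and>
        w k \<bullet> d k \<le> - a * (norm (d k))\<^sup>2 \<and> norm (w k) \<le> b * norm (d k) \<and>
        (\<exists>t\<in>{\<tau>min..\<tau>max}. \<exists>j. \<tau> k = \<beta> ^ j * t \<and>
           sufficient_decrease R \<phi> \<sigma> (\<R> k) (x k) (w k) (d k) (\<tau> k) \<and>
           (\<forall>i<j. \<not> sufficient_decrease R \<phi> \<sigma> (\<R> k) (x k) (w k) (d k) (\<beta> ^ i * t))) \<and>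
        x (Suc k) = R (x k) (\<tau> k *\<^sub>R d k) \<and>
        p (Suc k) \<in> {pmin..1} \<and>
        \<R> (Suc k) = (1 - p (Suc k)) * \<R> k + p (Suc k) * \<phi> (x (Suc k)))"

end

theory Submission
  imports Defs
begin

text \<open>
  Put \<open>E k = \<R> k - \<phi> xstar\<close>, which decreases to \<open>0\<close> by at least a multiple of \<open>\<tau> k * \<parallel>d k\<parallel>\<^sup>2\<close>. While
  \<open>x k\<close> is close to \<open>xstar\<close>, the quadratic upper bound keeps the stepsizes away from \<open>0\<close>.
  Since \<open>\<phi> (x k)\<close> may lie below \<open>\<R> k\<close>, the desingularization function \<open>\<psi>\<close> cannot be compared
  with \<open>E\<close> directly. If \<open>\<phi> (x k) - \<phi> xstar \<ge> E k / 2\<close>, then concavity and the KL inequality bound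
  \<open>\<parallel>d k\<parallel>\<close> by a multiple of \<open>\<psi> (E k / 2) - \<psi> (E (k + 1) / 2)\<close>. Otherwise the gap between \<open>\<R> k\<close>
  and \<open>\<phi> (x k)\<close>, which is at most a multiple of \<open>E (k - 1) - E k\<close>, exceeds \<open>E k / 2\<close>; hence
  \<open>E k \<le> q * E (k - 1)\<close> with \<open>q < 1\<close>, and \<open>\<parallel>d k\<parallel>\<close> is bounded by a multiple of
  \<open>sqrt (E (k - 1)) - sqrt (E k)\<close>. Both bounds telescope, so the iterates are trapped
  near \<open>xstar\<close>.
\<close>

section \<open>Trapping a sequence near an accumulation point\<close>

text \<open>The step bound is available only near \<open>z\<close>, so it cannot simply be summed. A
  late index \<open>k0\<close> of the subsequence starts within \<open>\<epsilon> / 2\<close> of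
  \<open>z\<close>, and the telescoped bound lets the path move by less than another
  \<open>\<epsilon> / 2\<close>. The path thus never leaves the ball in which the step bound
  holds.\<close>

lemma subsequence_trap:
  fixes x :: "nat \<Rightarrow> 'a::metric_space" and \<Psi> :: "nat \<Rightarrow> real"
  assumes s: "strict_mono s" "(x \<circ> s) \<longlonglongrightarrow> z"
    and \<Psi>: "\<Psi> \<longlonglongrightarrow> 0" "\<forall>\<^sub>F k in sequentially. 0 \<le> \<Psi> k"
    and \<rho>: "0 < \<rho>"
    and step: "\<forall>\<^sub>F k in sequentially. dist (x k) z < \<rho> \<longrightarrow> dist (x k) (x (Suc k)) \<le> \<Psi> k - \<Psi> (Suc k)"
  shows "x \<longlonglongrightarrow> z"
proof (rule metric_LIMSEQ_I)
  fix e :: real assume "0 < e"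
  define \<epsilon> where "\<epsilon> = min e \<rho>"
  have \<epsilon>: "0 < \<epsilon>" "\<epsilon> \<le> e" "\<epsilon> \<le> \<rho>" using \<open>0 < e\<close> \<rho> by (auto simp: \<epsilon>_def)
  have "\<forall>\<^sub>F k in sequentially. \<Psi> k < \<epsilon> / 2"
    using order_tendstoD(2)[OF \<Psi>(1), of "\<epsilon> / 2"] \<epsilon> by simp
  with \<Psi>(2) step have "\<forall>\<^sub>F k in sequentially. 0 \<le> \<Psi> k \<and> \<Psi> k < \<epsilon> / 2 \<and>
      (dist (x k) z < \<rho> \<longrightarrow> dist (x k) (x (Suc k)) \<le> \<Psi> k - \<Psi> (Suc k))"
    by eventually_elim auto
  then obtain N where N: "0 \<le> \<Psi> k" "\<Psi> k < \<epsilon> / 2"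
      "dist (x k) z < \<rho> \<Longrightarrow> dist (x k) (x (Suc k)) \<le> \<Psi> k - \<Psi> (Suc k)" if "N \<le> k" for k
    unfolding eventually_sequentially by blast
  obtain n0 where n0: "\<And>n. n0 \<le> n \<Longrightarrow> dist (x (s n)) z < \<epsilon> / 2"
    using metric_LIMSEQ_D[OF s(2), of "\<epsilon> / 2"] \<epsilon> by auto
  define k0 where "k0 = s (max N n0)"
  have k0: "N \<le> k0" "dist (x k0) z < \<epsilon> / 2"
    using seq_suble[OF s(1), of "max N n0"] n0[of "max N n0"] by (auto simp: k0_def)
  \<comment> \<open>As \<open>\<Psi> k\<close> is nonnegative, the path from \<open>k0\<close> to
    \<open>k\<close> is at most \<open>\<Psi> k0 < \<epsilon> / 2\<close> long. The induction below
    uses this to keep the local step bound applicable.\<close>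
  have close: "dist (x k) z < \<epsilon>" if "dist (x k0) (x k) \<le> \<Psi> k0 - \<Psi> k" "k0 \<le> k" for k
    using that dist_triangle3[of "x k" z "x k0"] N[of k] N[of k0] k0 by simp
  have "dist (x k0) (x k) \<le> \<Psi> k0 - \<Psi> k" if "k0 \<le> k" for k
    using that
  proof (induction k rule: dec_induct)
    case (step n)
    have "dist (x n) z < \<rho>" using close[OF step.IH step.hyps(1)] \<epsilon> by simp
    then show ?case
      using step N(3)[of n] k0 dist_triangle[of "x k0" "x (Suc n)" "x n"] by simp
  qed simp
  then show "\<exists>no. \<forall>n\<ge>no. dist (x n) z < e" using close \<epsilon> by fastforce
qed

section \<open>Desingularization functions and the length of one step\<close>

text \<open>Concavity: \<open>- \<psi>\<close> lies above its tangents. The point \<open>v\<close>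
  may be an endpoint, where no derivative is given.\<close>

lemma desingularization_tangent:
  assumes "desingularization \<eta> \<psi> \<psi>'" "0 < u" "u < \<eta>" "0 \<le> v" "v \<le> \<eta>"
  shows "\<psi> v \<le> \<psi> u + \<psi>' u * (v - u)"
proof -
  have "(\<lambda>t. - \<psi> t) v - (\<lambda>t. - \<psi> t) u \<ge> - \<psi>' u * (v - u)"
  proof (rule convex_on_imp_above_tangent)
    show "convex_on {0..\<eta>} (\<lambda>t. - \<psi> t)"
      using assms by (simp add: desingularization_def concave_on_def)
    show "connected {0..\<eta>}" by simp
    show "u \<in> interior {0..\<eta>}" "v \<in> {0..\<eta>}" using assms by auto
    have "((\<lambda>t. - \<psi> t) has_real_derivative - \<psi>' u) (at u)"
      using assms by (intro DERIV_minus) (auto simp: desingularization_def)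
    then show "((\<lambda>t. - \<psi> t) has_real_derivative - \<psi>' u) (at u within {0..\<eta>})"
      by (rule DERIV_subset) simp
  qed
  then show ?thesis by simp
qed

text \<open>Adding the tangent inequalities at \<open>u\<close> and at \<open>v\<close> compares the
  two slopes.\<close>

lemma desingularization_deriv_antimono:
  assumes d: "desingularization \<eta> \<psi> \<psi>'" and uv: "0 < u" "u \<le> v" "v < \<eta>"
  shows "\<psi>' v \<le> \<psi>' u"
proof (cases "u = v")
  case False
  have "\<psi> v \<le> \<psi> u + \<psi>' u * (v - u)" "\<psi> u \<le> \<psi> v + \<psi>' v * (u - v)"
    using uv by (auto intro!: desingularization_tangent[OF d])
  then have "0 \<le> (\<psi>' u - \<psi>' v) * (v - u)" by (simp add: algebra_simps)
  then show ?thesis using False uv by (simp add: zero_le_mult_iff)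
qed simp

text \<open>
  Here \<open>r0\<close>, \<open>r\<close>, \<open>r1\<close> are three consecutive values of \<open>E\<close>, while \<open>f\<close> and \<open>\<delta>\<close> stand for
  \<open>\<phi> (x k) - \<phi> xstar\<close> and \<open>\<parallel>d k\<parallel>\<close>.
\<close>

lemma nonmonotone_KL_step:
  fixes f r r0 r1 \<delta> b c q \<eta> :: real
  assumes des: "desingularization \<eta> \<psi> \<psi>'"
    and pos: "0 < b" "0 < c" "0 < q" "q \<le> 1" "0 \<le> \<delta>"
    and r: "0 \<le> r1" "0 < r" "r \<le> r0" "r < \<eta>"
    and dec: "c * \<delta>\<^sup>2 \<le> r - r1"
    and f: "f \<le> r" "q * (r - f) \<le> r0 - r"
    and KL: "0 < f \<Longrightarrow> 1 \<le> \<psi>' f * (b * \<delta>)"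
  shows "\<delta> \<le> 2 * b / c * (\<psi> (r / 2) - \<psi> (r1 / 2)) + 8 / (q * sqrt c) * (sqrt r0 - sqrt r)"
proof -
  have "0 \<le> c * \<delta>\<^sup>2" using pos by simp
  then have r1: "r1 \<le> r" using dec by linarith
  have \<psi>'pos: "0 < \<psi>' t" if "0 < t" "t < \<eta>" for t
    using des that by (simp add: desingularization_def)
  \<comment> \<open>The arguments are halved because the KL inequality concerns
    \<open>\<psi>' f\<close>, where \<open>f\<close> may be smaller than \<open>r\<close>. For
    \<open>r / 2 \<le> f\<close> the slope at \<open>r / 2\<close> dominates the slope at
    \<open>f\<close>.\<close>
  have "\<psi> (r1 / 2) \<le> \<psi> (r / 2) + \<psi>' (r / 2) * (r1 / 2 - r / 2)"
    using r r1 by (intro desingularization_tangent[OF des]) auto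
  then have tan: "\<psi>' (r / 2) * ((r - r1) / 2) \<le> \<psi> (r / 2) - \<psi> (r1 / 2)"
    by (simp add: algebra_simps diff_divide_distrib)
  \<comment> \<open>Both summands of the bound are nonnegative, so each case below only has to reach
    one of them.\<close>
  have \<psi>: "0 \<le> 2 * b / c * (\<psi> (r / 2) - \<psi> (r1 / 2))"
    using order_trans[OF _ tan, of 0] \<psi>'pos[of "r / 2"] r r1 pos by simp
  have sq: "0 \<le> 8 / (q * sqrt c) * (sqrt r0 - sqrt r)" using pos r by simp
  show ?thesis
  proof (cases "r / 2 \<le> f")
    case True
    have "\<psi>' f * (c * \<delta>\<^sup>2 / 2) \<le> \<psi>' (r / 2) * ((r - r1) / 2)"
      using True r f dec pos \<psi>'pos[of "r / 2"]
      by (intro mult_mono desingularization_deriv_antimono[OF des]) auto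
    then have "\<psi>' f * (c * \<delta>\<^sup>2 / 2) \<le> \<psi> (r / 2) - \<psi> (r1 / 2)" using tan by simp
    then have "2 * b / c * (\<psi>' f * (c * \<delta>\<^sup>2 / 2)) \<le> 2 * b / c * (\<psi> (r / 2) - \<psi> (r1 / 2))"
      using pos by (intro mult_left_mono) auto
    \<comment> \<open>The decrease is quadratic in \<open>\<delta>\<close>. The KL inequality
      absorbs one factor and leaves a bound linear in \<open>\<delta>\<close>.\<close>
    moreover have "2 * b / c * (\<psi>' f * (c * \<delta>\<^sup>2 / 2)) = \<delta> * (\<psi>' f * (b * \<delta>))"
      using pos by (simp add: power2_eq_square)
    moreover have "\<delta> * 1 \<le> \<delta> * (\<psi>' f * (b * \<delta>))"
      using KL True r pos by (intro mult_left_mono) auto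
    ultimately show ?thesis using sq by linarith
  next
    case False
    have "q * (r / 2) \<le> q * (r - f)" using False pos by (intro mult_left_mono) auto
    then have r0: "(1 + q / 2) * r \<le> r0" using f by (simp add: algebra_simps)
    have "q * q \<le> q * 1" using pos by (intro mult_left_mono) auto
    moreover have "(1 + q / 8)\<^sup>2 = 1 + q / 4 + q * q / 64" by (simp add: power2_eq_square algebra_simps)
    \<comment> \<open>The constant \<open>q / 8\<close> makes a perfect square fit below the growth
      factor \<open>1 + q / 2\<close>, so that taking square roots turns the growth into a
      difference of roots.\<close>
    ultimately have "(1 + q / 8)\<^sup>2 \<le> 1 + q / 2" using pos by linarith
    then have "(1 + q / 8)\<^sup>2 * r \<le> r0" using r0 r by (meson mult_right_mono order_trans less_imp_le)
    then have "sqrt ((1 + q / 8)\<^sup>2 * r) \<le> sqrt r0" by (rule real_sqrt_le_mono)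
    then have 1: "q / 8 * sqrt r \<le> sqrt r0 - sqrt r"
      using pos by (simp add: real_sqrt_mult algebra_simps)
    have "sqrt (c * \<delta>\<^sup>2) \<le> sqrt r" using dec r by (intro real_sqrt_le_mono) auto
    then have 2: "sqrt c * \<delta> \<le> sqrt r" using pos by (simp add: real_sqrt_mult)
    have "\<delta> = 8 / (q * sqrt c) * (q / 8 * (sqrt c * \<delta>))" using pos by (simp add: field_simps)
    also have "\<dots> \<le> 8 / (q * sqrt c) * (sqrt r0 - sqrt r)"
      using pos by (intro mult_left_mono order_trans[OF mult_left_mono[OF 2] 1]) auto
    finally show ?thesis using \<psi> by linarith
  qed
qed

section \<open>Normal directions in the subdifferentials of the extended function\<close>

text \<open>Off \<open>M\<close> the difference quotient is \<infinity>, so only points of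
  \<open>M\<close> constrain the lower limit. There all values are real, and the division can be
  cleared.\<close>

lemma frechet_subdiff_extended_fun:
  "v \<in> frechet_subdiff (extended_fun M \<phi>) x \<longleftrightarrow> x \<in> M \<and>
     (\<forall>e>0. \<forall>\<^sub>F y in at x. y \<in> M \<longrightarrow> - e * norm (y - x) \<le> \<phi> y - \<phi> x - v \<bullet> (y - x))"
  (is "_ \<longleftrightarrow> _ \<and> ?P")
proof (cases "x \<in> M")
  case True
  let ?q = "\<lambda>y. (extended_fun M \<phi> y - extended_fun M \<phi> x - ereal (v \<bullet> (y - x))) / ereal (norm (y - x))"
  have qM: "?q y = ereal ((\<phi> y - \<phi> x - v \<bullet> (y - x)) / norm (y - x))" if "y \<in> M" "y \<noteq> x" for y
    using that True by (simp add: extended_fun_def indicator_fun_def)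
  have qN: "?q y = \<infinity>" if "y \<notin> M" "y \<noteq> x" for y
    using that True by (simp add: extended_fun_def indicator_fun_def)
  have "0 \<le> Liminf (at x) ?q \<longleftrightarrow> ?P"
  proof
    assume L: "0 \<le> Liminf (at x) ?q"
    show ?P
    proof (intro allI impI)
      fix e :: real assume "0 < e"
      then have "\<forall>\<^sub>F y in at x. ereal (- e) < ?q y" using L[unfolded le_Liminf_iff] by simp
      then show "\<forall>\<^sub>F y in at x. y \<in> M \<longrightarrow> - e * norm (y - x) \<le> \<phi> y - \<phi> x - v \<bullet> (y - x)"
        using eventually_neq_at_within[of x x]
      proof eventually_elim
        case (elim y)
        then show ?case using qM[of y] by (auto simp: pos_less_divide_eq)
      qed
    qed
  next
    assume P: ?P
    show "0 \<le> Liminf (at x) ?q"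
      unfolding le_Liminf_iff
    proof (intro allI impI)
      fix l :: ereal assume "l < 0"
      \<comment> \<open>The bound \<open>l\<close> may be \<open>-\<infinity>\<close>; a real number
        in between supplies the \<open>e\<close> for the hypothesis.\<close>
      then obtain u where u: "l < ereal u" "ereal u < 0" using ereal_dense2 by blast
      define e where "e = - u"
      have e: "l < ereal (- e)" "0 < e" using u by (auto simp: e_def)
      from P e(2) have "\<forall>\<^sub>F y in at x. y \<in> M \<longrightarrow> - e * norm (y - x) \<le> \<phi> y - \<phi> x - v \<bullet> (y - x)"
        by blast
      then show "\<forall>\<^sub>F y in at x. l < ?q y"
        using eventually_neq_at_within[of x x]
      proof eventually_elim
        case (elim y)
        show ?case
        proof (cases "y \<in> M")
          case True
          then have "ereal (- e) \<le> ?q y" using elim qM[of y] by (simp add: pos_le_divide_eq)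
          then show ?thesis using e(1) by (rule less_le_trans[rotated])
        next
          case False
          then show ?thesis using elim qN[of y] e by (auto intro: less_trans)
        qed
      qed
    qed
  qed
  then show ?thesis
    using True by (simp add: frechet_subdiff_def extended_fun_def indicator_fun_def)
qed (simp add: frechet_subdiff_def extended_fun_def indicator_fun_def)

text \<open>Since \<open>F\<close> vanishes on \<open>M\<close> near \<open>x\<close>, its
  first-order expansion makes \<open>g \<bullet> (y - x)\<close> negligible against
  \<open>norm (y - x)\<close> for \<open>y\<close> in \<open>M\<close>. Tilting by a multiple of
  \<open>g\<close> therefore does not affect the criterion.\<close>

lemma frechet_subdiff_add_gradient:
  assumes v: "v \<in> frechet_subdiff (extended_fun M \<phi>) x"
    and F: "GDERIV F x :> g" and U: "open U" "x \<in> U" "\<And>y. y \<in> M \<inter> U \<Longrightarrow> F y = 0"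
  shows "v + c *\<^sub>R g \<in> frechet_subdiff (extended_fun M \<phi>) x"
  unfolding frechet_subdiff_extended_fun
proof (intro conjI allI impI)
  show x: "x \<in> M" using v by (simp add: frechet_subdiff_extended_fun)
  fix e :: real assume "0 < e"
  \<comment> \<open>Half of \<open>e\<close> is spent on \<open>v\<close>, half on the tilt; the
    summand 1 covers \<open>c = 0\<close>.\<close>
  define e' where "e' = e / (2 * (\<bar>c\<bar> + 1))"
  have e': "0 < e'" "\<bar>c\<bar> * e' \<le> e / 2" using \<open>0 < e\<close> by (auto simp: e'_def field_simps)
  have 1: "\<forall>\<^sub>F y in at x. y \<in> M \<longrightarrow> - (e / 2) * norm (y - x) \<le> \<phi> y - \<phi> x - v \<bullet> (y - x)"
    using v \<open>0 < e\<close> unfolding frechet_subdiff_extended_fun by (meson half_gt_zero)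
  have "\<exists>\<delta>>0. \<forall>y. norm (y - x) < \<delta> \<longrightarrow> norm (F y - F x - (y - x) \<bullet> g) \<le> e' * norm (y - x)"
    using F e'(1) unfolding gderiv_def has_derivative_at_alt by blast
  then obtain \<delta> where \<delta>: "0 < \<delta>"
      "\<And>y. norm (y - x) < \<delta> \<Longrightarrow> norm (F y - F x - (y - x) \<bullet> g) \<le> e' * norm (y - x)" by blast
  have 2: "\<forall>\<^sub>F y in at x. norm (y - x) < \<delta>"
    using \<delta>(1) unfolding eventually_at by (auto simp: dist_norm)
  have 3: "\<forall>\<^sub>F y in at x. y \<in> U" using U(1,2) by (rule eventually_at_in_open')
  show "\<forall>\<^sub>F y in at x. y \<in> M \<longrightarrow>
      - e * norm (y - x) \<le> \<phi> y - \<phi> x - (v + c *\<^sub>R g) \<bullet> (y - x)"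
    using 1 2 3
  proof eventually_elim
    case (elim y)
    show ?case
    proof
      assume y: "y \<in> M"
      have "\<bar>g \<bullet> (y - x)\<bar> \<le> e' * norm (y - x)"
        using \<delta>(2)[OF elim(2)] U x y elim(3) by (simp add: inner_commute)
      then have "\<bar>c\<bar> * \<bar>g \<bullet> (y - x)\<bar> \<le> \<bar>c\<bar> * (e' * norm (y - x))" by (rule mult_left_mono) simp
      also have "\<dots> \<le> e / 2 * norm (y - x)"
        using mult_right_mono[OF e'(2) norm_ge_zero[of "y - x"]] by (simp add: mult.assoc)
      finally have "c * (g \<bullet> (y - x)) \<le> e / 2 * norm (y - x)"
        using abs_ge_self[of "c * (g \<bullet> (y - x))"] by (simp only: abs_mult)
      then show "- e * norm (y - x) \<le> \<phi> y - \<phi> x - (v + c *\<^sub>R g) \<bullet> (y - x)"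
        using elim(1) y by (simp add: inner_add_left)
    qed
  qed
qed

text \<open>The gradient at each approximating point is added to the subgradient there; continuity
  of \<open>G\<close> carries the sum to the limit.\<close>

lemma limiting_subdiff_add_gradient:
  assumes v: "v \<in> limiting_subdiff (extended_fun M \<phi>) x"
    and F: "\<And>y. y \<in> U \<Longrightarrow> GDERIV F y :> G y" "continuous_on U G"
    and U: "open U" "x \<in> U" "\<And>y. y \<in> M \<inter> U \<Longrightarrow> F y = 0"
  shows "v + c *\<^sub>R G x \<in> limiting_subdiff (extended_fun M \<phi>) x"
proof -
  let ?\<Phi> = "extended_fun M \<phi>"
  obtain xs vs where vs: "\<And>k. vs k \<in> frechet_subdiff ?\<Phi> (xs k)"
    and lim: "xs \<longlonglongrightarrow> x" "(\<lambda>k. ?\<Phi> (xs k)) \<longlonglongrightarrow> ?\<Phi> x" "vs \<longlonglongrightarrow> v" and fin: "\<bar>?\<Phi> x\<bar> \<noteq> \<infinity>"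
    using v by (auto simp: limiting_subdiff_def)
  obtain N where N: "\<And>k. N \<le> k \<Longrightarrow> xs k \<in> U"
    using topological_tendstoD[OF lim(1) U(1,2)] unfolding eventually_sequentially by blast
  \<comment> \<open>The definition asks for a subgradient at every index, so the initial terms
    outside \<open>U\<close> are cut off.\<close>
  define ys where "ys k = xs (k + N)" for k
  have ysU: "ys k \<in> U" for k using N by (simp add: ys_def)
  have "ys \<longlonglongrightarrow> x" unfolding ys_def using lim(1) by (rule LIMSEQ_ignore_initial_segment)
  moreover have "(\<lambda>k. G (ys k)) \<longlonglongrightarrow> G x"
    using continuous_on_tendsto_compose[OF F(2) \<open>ys \<longlonglongrightarrow> x\<close> U(2)] ysU by simp
  then have "(\<lambda>k. vs (k + N) + c *\<^sub>R G (ys k)) \<longlonglongrightarrow> v + c *\<^sub>R G x"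
    by (intro tendsto_intros LIMSEQ_ignore_initial_segment lim(3))
  moreover have "vs (k + N) + c *\<^sub>R G (ys k) \<in> frechet_subdiff ?\<Phi> (ys k)" for k
    using vs[of "k + N"] ysU[of k] F(1) U
    by (intro frechet_subdiff_add_gradient[where F = F and U = U]) (auto simp: ys_def)
  moreover have "(\<lambda>k. ?\<Phi> (ys k)) \<longlonglongrightarrow> ?\<Phi> x"
    unfolding ys_def using lim(2) by (rule LIMSEQ_ignore_initial_segment)
  ultimately show ?thesis using fin unfolding limiting_subdiff_def
    by (intro CollectI conjI exI[of _ ys] exI[of _ "\<lambda>k. vs (k + N) + c *\<^sub>R G (ys k)"]) auto
qed

lemma subspace_tangent_space:
  assumes "embedded_submanifold M" "x \<in> M"
  shows "subspace (tangent_space M x)"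
proof -
  obtain m U F G where "local_defining_map M m x U F G"
    using assms unfolding embedded_submanifold_def by blast
  then show ?thesis
    using tangent_space_eq_kernel[OF assms(2)] by (auto simp: subspace_def inner_add_right)
qed

text \<open>Projection removes from \<open>v\<close> only a normal vector, that is, a combination of
  the gradients \<open>G i x\<close>. This inclusion lets the KL property, stated for the limiting
  subdifferential, be applied to the projected subgradients of the method.\<close>

lemma proj_subdiff_subset_limiting_subdiff:
  assumes M: "embedded_submanifold M" and x: "x \<in> M"
  shows "proj_subdiff M \<phi> x \<subseteq> limiting_subdiff (extended_fun M \<phi>) x"
proof
  fix w assume "w \<in> proj_subdiff M \<phi> x"
  let ?T = "tangent_space M x" and ?D = "limiting_subdiff (extended_fun M \<phi>) x"
  obtain v where v: "v \<in> ?D" and w: "w = closest_point ?T v"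
    using \<open>w \<in> proj_subdiff M \<phi> x\<close> by (auto simp: proj_subdiff_def)
  obtain m U F G where FG: "local_defining_map M m x U F G"
    using M x unfolding embedded_submanifold_def by blast
  let ?S = "span ((\<lambda>i. G i x) ` {..<m})"
  have T: "?T = {\<xi>. \<forall>i<m. G i x \<bullet> \<xi> = 0}" by (rule tangent_space_eq_kernel[OF x FG])
  have sub: "subspace ?T" by (rule subspace_tangent_space[OF M x])
  have wT: "w \<in> ?T"
    unfolding w using sub subspace_0[OF sub] by (intro closest_point_in_set closed_subspace) auto
  have "(v - w) \<bullet> (y - w) \<le> 0" if "y \<in> ?T" for y
    unfolding w using sub that
    by (intro closest_point_dot subspace_imp_convex closed_subspace) auto
  note dot = this
  \<comment> \<open>Testing the variational inequality at \<open>w + y\<close> and at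
    \<open>w - y\<close> turns it into an equality.\<close>
  have perp: "(v - w) \<bullet> y = 0" if "y \<in> ?T" for y
    using dot[OF subspace_add[OF sub that wT]] dot[OF subspace_diff[OF sub wT that]]
    by (simp add: inner_diff_right)
  \<comment> \<open>\<open>M\<close> is the zero set of the \<open>F i\<close> near \<open>x\<close>, so normal vectors can be added to subgradients.\<close>
  have add: "u - n \<in> ?D" if "n \<in> ?S" "u \<in> ?D" for n u
    using that
  proof (induction arbitrary: u rule: span_induct_alt)
    case (step c g n)
    then obtain i where i: "i < m" "g = G i x" by auto
    have "u + (- c) *\<^sub>R G i x \<in> ?D"
      using step.prems FG i(1)
      by (intro limiting_subdiff_add_gradient[where U = U and F = "F i"])
        (auto simp: local_defining_map_def)
    then have "(u + (- c) *\<^sub>R G i x) - n \<in> ?D" by (rule step.IH)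
    then show ?case using i by (simp add: algebra_simps)
  qed simp
  \<comment> \<open>The part \<open>t\<close> orthogonal to all gradients is tangent, hence
    orthogonal to \<open>v - w\<close> and to \<open>n\<close>, hence zero.\<close>
  obtain n t where nt: "n \<in> ?S" "\<And>y. y \<in> ?S \<Longrightarrow> orthogonal t y" "v - w = n + t"
    using orthogonal_subspace_decomp_exists[of "(\<lambda>i. G i x) ` {..<m}" "v - w"] by blast
  have "t \<bullet> G i x = 0" if "i < m" for i
    using nt(2)[of "G i x"] that by (simp add: orthogonal_def span_base)
  then have "t \<in> ?T" by (simp add: T inner_commute)
  then have "(n + t) \<bullet> t = 0" using perp nt(3) by metis
  moreover have "n \<bullet> t = 0" using nt(2)[OF nt(1)] by (simp add: orthogonal_def inner_commute)
  ultimately have "t = 0" by (simp add: inner_add_left)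
  then have "w = v - n" using nt(3) by (simp add: algebra_simps)
  then show "w \<in> ?D" using add[OF nt(1) v] by simp
qed

section \<open>Local estimates: retraction, KL inequality, stepsizes\<close>

text \<open>The mean value inequality is applied between \<open>(y, 0)\<close> and
  \<open>(y, \<xi>)\<close>, where \<open>R y 0 = y\<close>. It is applied to the smooth extension
  \<open>f\<close>, which lives on a full ball, with its derivative bounded there by
  continuity.\<close>

lemma retraction_on_locally_Lipschitz:
  assumes M: "embedded_submanifold M" and R: "retraction_on M R" and z: "z \<in> M"
  obtains L \<delta> where "0 < L" "0 < \<delta>"
    "\<And>y \<xi>. y \<in> M \<Longrightarrow> \<xi> \<in> tangent_space M y \<Longrightarrow> dist y z < \<delta> \<Longrightarrow> norm \<xi> < \<delta> \<Longrightarrow>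
       dist y (R y \<xi>) \<le> L * norm \<xi>"
proof -
  have zero: "(y, 0) \<in> tangent_bundle M" if "y \<in> M" for y
    using that subspace_0[OF subspace_tangent_space[OF M that]] by (simp add: tangent_bundle_def)
  obtain W f where W: "open W" "(z, 0) \<in> W" and f: "C2_map_on f W"
    and Rf: "\<And>y \<eta>. (y, \<eta>) \<in> W \<Longrightarrow> (y, \<eta>) \<in> tangent_bundle M \<Longrightarrow> R y \<eta> = f (y, \<eta>)"
  proof -
    have "\<forall>p\<in>tangent_bundle M. \<exists>W f. open W \<and> p \<in> W \<and> C2_map_on f W \<and>
        (\<forall>(y, \<eta>)\<in>W \<inter> tangent_bundle M. R y \<eta> = f (y, \<eta>))"
      using R unfolding retraction_on_def by blast
    from bspec[OF this zero[OF z]] show ?thesis using that by blast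
  qed
  obtain f' where f': "\<And>q. q \<in> W \<Longrightarrow> (f has_derivative blinfun_apply (f' q)) (at q)"
    and C1: "C1_map_on f' W"
    using f unfolding C2_map_on_def by blast
  have "isCont f' (z, 0)"
    using C1 W(2) has_derivative_continuous unfolding C1_map_on_def by blast
  then have "isCont (\<lambda>q. norm (f' q)) (z, 0)" by (rule isCont_norm)
  then have "((\<lambda>q. norm (f' q)) \<longlongrightarrow> norm (f' (z, 0))) (nhds (z, 0))"
    unfolding isCont_def by (rule tendsto_at_iff_tendsto_nhds[THEN iffD1])
  then have "\<forall>\<^sub>F q in nhds (z, 0). norm (f' q) < norm (f' (z, 0)) + 1"
    by (rule order_tendstoD(2)) simp
  moreover have "\<forall>\<^sub>F q in nhds (z, 0). q \<in> W" using W by (rule eventually_nhds_in_open)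
  ultimately have "\<forall>\<^sub>F q in nhds (z, 0). q \<in> W \<and> norm (f' q) < norm (f' (z, 0)) + 1"
    by eventually_elim simp
  then obtain e where e: "0 < e" "\<And>q. dist q (z, 0::'a) < e \<Longrightarrow> q \<in> W \<and> norm (f' q) < norm (f' (z, 0)) + 1"
    unfolding eventually_nhds_metric by blast
  let ?L = "norm (f' (z, 0)) + 1"
  show thesis
  proof
    show "0 < ?L" by (simp add: add_nonneg_pos)
    show "0 < e / 2" using e by simp
    fix y \<xi> assume y: "y \<in> M" "\<xi> \<in> tangent_space M y" "dist y z < e / 2" "norm \<xi> < e / 2"
    have "dist (y, \<xi>) (z, 0) \<le> dist y z + norm \<xi>"
      by (simp add: dist_Pair_Pair) (rule sqrt_sum_squares_le_sum; simp)
    then have in1: "dist (y, \<xi>) (z, 0) < e" using y by simp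
    have in2: "dist (y, 0) (z, 0) < e" using y e by (simp add: dist_Pair_Pair)
    have "norm (f (y, \<xi>) - f (y, 0)) \<le> ?L * norm ((y, \<xi>) - (y, 0))"
    proof (rule differentiable_bound[where S = "ball (z, 0::'a) e"])
      fix q assume "q \<in> ball (z, 0::'a) e"
      then have q: "q \<in> W" "norm (f' q) < ?L" using e(2)[of q] by (auto simp: dist_commute)
      show "(f has_derivative blinfun_apply (f' q)) (at q within ball (z, 0::'a) e)"
        using f'[OF q(1)] by (rule has_derivative_at_withinI)
      show "onorm (blinfun_apply (f' q)) \<le> ?L" using q(2) by (simp add: norm_blinfun.rep_eq)
    qed (use in1 in2 in \<open>auto simp: dist_commute\<close>)
    moreover have "R y \<xi> = f (y, \<xi>)"
      using Rf e(2)[OF in1] y by (simp add: tangent_bundle_def)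
    moreover have "y = f (y, 0)"
      using Rf[of y 0] e(2)[OF in2] zero[OF y(1)] R y(1) by (auto simp: retraction_on_def)
    ultimately show "dist y (R y \<xi>) \<le> ?L * norm \<xi>"
      by (simp add: dist_norm norm_minus_commute norm_Pair)
  qed
qed

lemma KL_inequality_at_subgradient:
  assumes KL: "1 \<le> ereal c * ext_dist 0 S" and c: "0 < c" and w: "w \<in> S"
  shows "1 \<le> c * norm w"
proof -
  have "ext_dist 0 S \<le> ereal (norm w)"
    unfolding ext_dist_def using w by (intro INF_lower2[of w]) (auto simp: dist_norm)
  then have "ereal c * ext_dist 0 S \<le> ereal c * ereal (norm w)"
    using c by (intro ereal_mult_left_mono) auto
  then have "1 \<le> ereal c * ereal (norm w)" using KL by (rule order_trans[rotated])
  then show ?thesis by (simp add: one_ereal_def)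
qed

text \<open>If backtracking took place, the trial step \<open>u\<close> just before
  \<open>\<tau>\<close> was rejected. A step below \<open>\<rho> / D\<close> stays in the range of
  the quadratic upper bound, and below \<open>(1 - \<sigma>) * a / \<kappa>\<close> the quadratic
  term is absorbed by the share \<open>1 - \<sigma>\<close> of the linear decrease. Both together
  would force acceptance, as \<open>\<phi> y \<le> r\<close>.\<close>

lemma backtracking_stepsize_lower_bound:
  assumes pos: "0 < \<sigma>" "\<sigma> < 1" "0 < \<beta>" "0 < a" "0 < \<kappa>" "0 < \<rho>" "0 < D"
    and t: "\<tau>min \<le> t" "0 < \<tau>min" and \<tau>: "\<tau> = \<beta> ^ j * t"
    and rej: "\<forall>i<j. \<not> sufficient_decrease R \<phi> \<sigma> r y w d (\<beta> ^ i * t)"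
    and r: "\<phi> y \<le> r" and wd: "w \<bullet> d \<le> - a * (norm d)\<^sup>2" and d: "norm d \<le> D"
    and descent: "\<And>u. norm (u *\<^sub>R d) \<le> \<rho> \<Longrightarrow>
      \<phi> (R y (u *\<^sub>R d)) - (\<phi> y + w \<bullet> (u *\<^sub>R d)) \<le> \<kappa> * (norm (u *\<^sub>R d))\<^sup>2"
  shows "min \<tau>min (\<beta> * min ((1 - \<sigma>) * a / \<kappa>) (\<rho> / D)) \<le> \<tau>"
proof (cases j)
  case 0
  then show ?thesis using t \<tau> by simp
next
  case (Suc i)
  define u where "u = \<beta> ^ i * t"
  have u: "0 < u" "\<tau> = \<beta> * u" using pos t \<tau> Suc by (simp_all add: u_def)
  have "min ((1 - \<sigma>) * a / \<kappa>) (\<rho> / D) \<le> u"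
  proof (rule ccontr)
    assume "\<not> ?thesis"
    then have small: "u \<le> (1 - \<sigma>) * a / \<kappa>" "u \<le> \<rho> / D" by auto
    have "norm (u *\<^sub>R d) \<le> u * D" using u d by (simp add: mult_left_mono)
    also have "\<dots> \<le> \<rho>" using small(2) pos by (simp add: pos_le_divide_eq)
    finally have "\<phi> (R y (u *\<^sub>R d)) \<le> \<phi> y + u * (w \<bullet> d) + \<kappa> * (u * norm d)\<^sup>2"
      using descent[of u] u by simp
    moreover have "\<kappa> * (u * norm d)\<^sup>2 \<le> - ((1 - \<sigma>) * u * (w \<bullet> d))"
    proof -
      have "\<kappa> * (u * norm d)\<^sup>2 = (\<kappa> * u) * (u * (norm d)\<^sup>2)"
        by (simp add: power2_eq_square algebra_simps)
      also have "\<dots> \<le> ((1 - \<sigma>) * a) * (u * (norm d)\<^sup>2)"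
        using small(1) pos u by (intro mult_right_mono) (auto simp: pos_le_divide_eq mult.commute)
      also have "\<dots> = (1 - \<sigma>) * u * (a * (norm d)\<^sup>2)" by (simp add: algebra_simps)
      also have "\<dots> \<le> (1 - \<sigma>) * u * - (w \<bullet> d)"
        using wd pos u by (intro mult_left_mono) auto
      finally show ?thesis by simp
    qed
    ultimately have "\<phi> (R y (u *\<^sub>R d)) \<le> r + \<sigma> * u * (w \<bullet> d)"
      using r by (simp add: algebra_simps)
    then show False using rej Suc by (auto simp: sufficient_decrease_def u_def)
  qed
  then show ?thesis using u pos by (intro min.coboundedI2) simp
qed

section \<open>The nonmonotone reference values\<close>

text \<open>The decreasing \<open>r\<close> is bounded below by \<open>l\<close>, so its increments
  vanish. The gap condition then forces \<open>r - u\<close> to zero, and the subsequence identifies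
  the limit.\<close>

lemma nonmonotone_reference_limit:
  fixes u r :: "nat \<Rightarrow> real"
  assumes dec: "decseq r" and ur: "\<And>k. u k \<le> r k" and q: "0 < q"
    and gap: "\<And>k. q * (r (Suc k) - u (Suc k)) \<le> r k - r (Suc k)"
    and s: "strict_mono s" "(u \<circ> s) \<longlonglongrightarrow> l"
  shows "r \<longlonglongrightarrow> l" "l \<le> r k"
proof -
  have low: "l \<le> r k" for k
  proof (rule LIMSEQ_le_const2[OF s(2)])
    have "(u \<circ> s) n \<le> r k" if "k \<le> n" for n
      using ur[of "s n"] decseqD[OF dec, of k "s n"] seq_suble[OF s(1), of n] that by simp
    then show "\<exists>N. \<forall>n\<ge>N. (u \<circ> s) n \<le> r k" by blast
  qed
  then show "l \<le> r k" .
  obtain l' where l': "r \<longlonglongrightarrow> l'" using decseq_convergent[OF dec] low by blast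
  have "(\<lambda>k. (r k - r (Suc k)) / q) \<longlonglongrightarrow> (l' - l') / q"
    by (intro tendsto_intros l' LIMSEQ_Suc) (use q in auto)
  then have 0: "(\<lambda>k. (r k - r (Suc k)) / q) \<longlonglongrightarrow> 0" by simp
  have "r (Suc k) - u (Suc k) \<le> (r k - r (Suc k)) / q" for k
    using gap[of k] q by (simp add: pos_le_divide_eq mult.commute)
  then have "(\<lambda>k. r (Suc k) - u (Suc k)) \<longlonglongrightarrow> 0"
    using ur by (intro real_tendsto_sandwich[OF _ _ tendsto_const 0] always_eventually) auto
  then have "(\<lambda>k. r k - u k) \<longlonglongrightarrow> 0" by (rule LIMSEQ_imp_Suc)
  then have "((\<lambda>k. r k - u k) \<circ> s) \<longlonglongrightarrow> 0" by (rule LIMSEQ_subseq_LIMSEQ[OF _ s(1)])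
  from tendsto_add[OF this s(2)] have "(r \<circ> s) \<longlonglongrightarrow> l" by (simp add: o_def)
  moreover have "(r \<circ> s) \<longlonglongrightarrow> l'" using l' s(1) by (rule LIMSEQ_subseq_LIMSEQ)
  ultimately show "r \<longlonglongrightarrow> l" using l' LIMSEQ_unique by blast
qed

text \<open>All estimates on the reference values rest on the identity \<open>diff\<close>, which
  rewrites the averaging rule as \<open>\<R> k - \<R> (Suc k) = p (Suc k) * (\<R> k - \<phi> (x (Suc
  k)))\<close>.\<close>

lemma infinite_run_decrease:
  assumes run: "infinite_run M R \<phi> \<tau>min \<tau>max \<sigma> \<beta> pmin a b x w d \<tau> p \<R>"
    and pos: "0 < \<tau>min" "0 < \<sigma>" "0 < \<beta>" "\<beta> < 1" "0 < pmin" "0 < a"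
  shows infinite_run_stepsize: "0 < \<tau> k" "\<tau> k \<le> \<tau>max"
    and infinite_run_reference_decrease: "pmin * \<sigma> * a * \<tau> k * (norm (d k))\<^sup>2 \<le> \<R> k - \<R> (Suc k)"
    and infinite_run_le_reference: "\<phi> (x k) \<le> \<R> k"
    and infinite_run_gap: "pmin * (\<R> (Suc k) - \<phi> (x (Suc k))) \<le> \<R> k - \<R> (Suc k)"
proof -
  have step: "w k \<bullet> d k \<le> - a * (norm (d k))\<^sup>2"
      "\<exists>t\<in>{\<tau>min..\<tau>max}. \<exists>j. \<tau> k = \<beta> ^ j * t"
      "\<phi> (x (Suc k)) \<le> \<R> k + \<sigma> * \<tau> k * (w k \<bullet> d k)"
      "pmin \<le> p (Suc k)" "p (Suc k) \<le> 1"
      "\<R> (Suc k) = (1 - p (Suc k)) * \<R> k + p (Suc k) * \<phi> (x (Suc k))" for k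
    using run unfolding infinite_run_def sufficient_decrease_def by (auto; metis)+
  have \<tau>: "0 < \<tau> k" "\<tau> k \<le> \<tau>max" for k
  proof -
    obtain t j where t: "\<tau>min \<le> t" "t \<le> \<tau>max" "\<tau> k = \<beta> ^ j * t"
      using step(2)[of k] unfolding atLeastAtMost_iff Bex_def by blast
    show "0 < \<tau> k" using t pos by simp
    have "\<beta> ^ j * t \<le> 1 * t" using pos t by (intro mult_right_mono power_le_one) auto
    then show "\<tau> k \<le> \<tau>max" using t by simp
  qed
  then show "0 < \<tau> k" "\<tau> k \<le> \<tau>max" by auto
  have suff: "\<sigma> * a * \<tau> k * (norm (d k))\<^sup>2 \<le> \<R> k - \<phi> (x (Suc k))" for k
  proof -
    have "\<sigma> * \<tau> k * (w k \<bullet> d k) \<le> \<sigma> * \<tau> k * (- a * (norm (d k))\<^sup>2)"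
      using pos \<tau>[of k] step(1) by (intro mult_left_mono) auto
    then show ?thesis using step(3)[of k] by (simp add: algebra_simps)
  qed
  have nn: "0 \<le> \<sigma> * a * \<tau> k * (norm (d k))\<^sup>2" for k using pos \<tau>[of k] by simp
  have diff: "\<R> k - \<R> (Suc k) = p (Suc k) * (\<R> k - \<phi> (x (Suc k)))" for k
    using step(6)[of k] by (simp add: algebra_simps)
  show "pmin * \<sigma> * a * \<tau> k * (norm (d k))\<^sup>2 \<le> \<R> k - \<R> (Suc k)"
    using mult_mono[OF step(4)[of k] suff[of k]] pos nn[of k] step(4)[of k]
    by (simp add: diff mult.assoc)
  have below: "\<phi> (x (Suc k)) \<le> \<R> (Suc k)" for k
  proof -
    have "(1 - p (Suc k)) * \<phi> (x (Suc k)) \<le> (1 - p (Suc k)) * \<R> k"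
      using step(5)[of k] suff[of k] nn[of k] by (intro mult_left_mono) auto
    then show ?thesis using step(6)[of k] by (simp add: algebra_simps)
  qed
  moreover have "\<phi> (x 0) \<le> \<R> 0" using run by (simp add: infinite_run_def)
  ultimately show "\<phi> (x k) \<le> \<R> k" by (cases k) auto
  have "0 \<le> \<R> k - \<R> (Suc k)"
    unfolding diff using step(4)[of k] pos suff[of k] nn[of k] by (intro mult_nonneg_nonneg) auto
  then have "pmin * (\<R> (Suc k) - \<phi> (x (Suc k))) \<le> p (Suc k) * (\<R> k - \<phi> (x (Suc k)))"
    using step(4)[of k] pos below[of k] by (intro mult_mono) auto
  then show "pmin * (\<R> (Suc k) - \<phi> (x (Suc k))) \<le> \<R> k - \<R> (Suc k)" by (simp add: diff)
qed

section \<open>Convergence of the entire sequence\<close>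

theorem theorem4p4:
  fixes M :: "'a::euclidean_space set"
    and R :: "'a \<Rightarrow> 'a \<Rightarrow> 'a"
    and \<phi> :: "'a \<Rightarrow> real"
    and \<tau>min \<tau>max \<sigma> \<beta> pmin a b :: real
    and x w d :: "nat \<Rightarrow> 'a"
    and \<tau> p \<R> :: "nat \<Rightarrow> real"
    and s :: "nat \<Rightarrow> nat"
    and xstar :: 'a
  assumes "embedded_submanifold M"
    and "retraction_on M R"
    and "continuous_on M \<phi>"
    and "locally_bounded_on M (proj_subdiff M \<phi>)"
    and "\<forall>xbar\<in>M. \<exists>\<kappa>>0. \<exists>r>0. \<exists>V. openin (top_of_set M) V \<and> xbar \<in> V \<and>
           (\<forall>y\<in>V. \<forall>\<xi>\<in>tangent_space M y. norm \<xi> \<le> r \<longrightarrow>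
              (\<forall>v\<in>proj_subdiff M \<phi> y. \<phi> (R y \<xi>) - (\<phi> y + v \<bullet> \<xi>) \<le> \<kappa> * (norm \<xi>)\<^sup>2))"
    and "0 < \<tau>min" and "\<tau>min \<le> \<tau>max"
    and "0 < \<sigma>" and "\<sigma> < 1" and "0 < \<beta>" and "\<beta> < 1" and "0 < pmin" and "pmin \<le> 1"
    and "0 < a" and "0 < b"
    and "infinite_run M R \<phi> \<tau>min \<tau>max \<sigma> \<beta> pmin a b x w d \<tau> p \<R>"
    and "strict_mono s" and "(x \<circ> s) \<longlonglongrightarrow> xstar" and "xstar \<in> M"
    and "KL_property (extended_fun M \<phi>) xstar"
  shows "x \<longlonglongrightarrow> xstar"
proof -
  note M = assms(1) and run = assms(16) and s = assms(17,18) and xstar = assms(19)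
  note pos = assms(6-15)
  note dec = infinite_run_decrease[OF run pos(1,3,5,6,7,9)]
  have it: "w k \<in> proj_subdiff M \<phi> (x k)" "d k \<in> tangent_space M (x k)" "d k \<noteq> 0"
      "w k \<bullet> d k \<le> - a * (norm (d k))\<^sup>2" "norm (w k) \<le> b * norm (d k)"
      "x (Suc k) = R (x k) (\<tau> k *\<^sub>R d k)" for k
    using run unfolding infinite_run_def by auto
  have bt: "\<exists>t j. \<tau>min \<le> t \<and> \<tau> k = \<beta> ^ j * t \<and>
      (\<forall>i<j. \<not> sufficient_decrease R \<phi> \<sigma> (\<R> k) (x k) (w k) (d k) (\<beta> ^ i * t))" for k
    using run unfolding infinite_run_def by (meson atLeastAtMost_iff)
  \<comment> \<open>\<open>tangent_space M y\<close> is empty for \<open>y\<close> outside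
    \<open>M\<close>.\<close>
  have xM: "x k \<in> M" for k using it(2)[of k] by (auto simp: tangent_space_def)
  have sub: "subspace (tangent_space M (x k))" for k by (rule subspace_tangent_space[OF M xM])

  define E where "E k = \<R> k - \<phi> xstar" for k
  have decR: "\<R> (Suc k) < \<R> k" for k
  proof -
    have "0 < pmin * \<sigma> * a * \<tau> k * (norm (d k))\<^sup>2" using pos dec(1)[of k] it(3)[of k] by simp
    then show ?thesis using dec(3)[of k] by linarith
  qed
  have lim: "\<R> \<longlonglongrightarrow> \<phi> xstar" "\<phi> xstar \<le> \<R> k" for k
  proof -
    have "((\<lambda>k. \<phi> (x k)) \<circ> s) \<longlonglongrightarrow> \<phi> xstar"
      using continuous_on_tendsto_compose[OF assms(3) s(2) xstar] xM by (simp add: o_def)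
    moreover have "decseq \<R>" using decR by (intro decseq_SucI less_imp_le)
    ultimately show "\<R> \<longlonglongrightarrow> \<phi> xstar" "\<phi> xstar \<le> \<R> k"
      using nonmonotone_reference_limit[where u = "\<lambda>k. \<phi> (x k)", OF _ dec(4) pos(7) dec(5) s(1)]
      by blast+
  qed
  \<comment> \<open>The decrease is strict because \<open>d k\<close> is nonzero. Positivity of
    \<open>E k\<close> allows the tangent of \<open>\<psi>\<close> at
    \<open>E k / 2\<close>.\<close>
  have Epos: "0 < E k" for k using lim(2)[of "Suc k"] decR[of k] by (simp add: E_def)
  have E0: "E \<longlonglongrightarrow> 0" using tendsto_diff[OF lim(1) tendsto_const[of "\<phi> xstar"]] by (simp add: E_def[abs_def])

  obtain \<kappa> r V where \<kappa>: "0 < \<kappa>" "0 < r" and V: "openin (top_of_set M) V" "xstar \<in> V"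
    and descent: "\<And>y \<xi> v. y \<in> V \<Longrightarrow> \<xi> \<in> tangent_space M y \<Longrightarrow> norm \<xi> \<le> r \<Longrightarrow>
      v \<in> proj_subdiff M \<phi> y \<Longrightarrow> \<phi> (R y \<xi>) - (\<phi> y + v \<bullet> \<xi>) \<le> \<kappa> * (norm \<xi>)\<^sup>2"
    using bspec[OF assms(5) xstar] by (elim exE conjE) (rule that, assumption+, simp)
  obtain V' where V': "openin (top_of_set M) V'" "xstar \<in> V'"
    and "bounded (\<Union>y\<in>V'. proj_subdiff M \<phi> y)"
    using assms(4) xstar unfolding locally_bounded_on_def by blast
  then obtain B where B: "0 < B" "\<And>y v. y \<in> V' \<Longrightarrow> v \<in> proj_subdiff M \<phi> y \<Longrightarrow> norm v \<le> B"
    unfolding bounded_pos by blast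
  obtain L \<delta> where L: "0 < L" "0 < \<delta>"
    and Lip: "\<And>y \<xi>. y \<in> M \<Longrightarrow> \<xi> \<in> tangent_space M y \<Longrightarrow> dist y xstar < \<delta> \<Longrightarrow> norm \<xi> < \<delta> \<Longrightarrow>
       dist y (R y \<xi>) \<le> L * norm \<xi>"
    using retraction_on_locally_Lipschitz[OF M assms(2) xstar] by metis
  obtain \<eta> U \<psi> \<psi>' where \<eta>: "0 < \<eta>" and U: "open U" "xstar \<in> U" and des: "desingularization \<eta> \<psi> \<psi>'"
    and KL: "\<And>y. y \<in> U \<Longrightarrow> extended_fun M \<phi> xstar < extended_fun M \<phi> y \<Longrightarrow>
      extended_fun M \<phi> y < extended_fun M \<phi> xstar + ereal \<eta> \<Longrightarrow>
      1 \<le> ereal (\<psi>' (real_of_ereal (extended_fun M \<phi> y - extended_fun M \<phi> xstar))) *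
        ext_dist 0 (limiting_subdiff (extended_fun M \<phi>) y)"
    using assms(20) unfolding KL_property_def by blast

  \<comment> \<open>\<open>D\<close> will bound \<open>norm (d k)\<close> near \<open>xstar\<close>:
    there \<open>a * norm (d k)\<close> is at most \<open>norm (w k)\<close>, hence at most
    \<open>B\<close>.\<close>
  define D where "D = B / a"
  define \<tau>low where "\<tau>low = min \<tau>min (\<beta> * min ((1 - \<sigma>) * a / \<kappa>) (r / D))"
  define c where "c = pmin * \<sigma> * a * \<tau>low"
  have D: "0 < D" using B pos by (simp add: D_def)
  have \<tau>low: "0 < \<tau>low" using pos \<kappa> D by (simp add: \<tau>low_def)
  have c: "0 < c" using pos \<tau>low by (simp add: c_def)
  have \<tau>max: "0 < \<tau>max" using pos by simp

  obtain \<rho>1 where \<rho>1: "0 < \<rho>1" "ball xstar \<rho>1 \<inter> M \<subseteq> V" using V openin_contains_ball by metis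
  obtain \<rho>2 where \<rho>2: "0 < \<rho>2" "ball xstar \<rho>2 \<inter> M \<subseteq> V'" using V' openin_contains_ball by metis
  obtain \<rho>3 where \<rho>3: "0 < \<rho>3" "ball xstar \<rho>3 \<subseteq> U" using U open_contains_ball by metis
  \<comment> \<open>Within \<open>\<rho>\<close> of \<open>xstar\<close> the quadratic upper bound,
    the bound \<open>B\<close>, the KL inequality and the retraction estimate are all at
    hand.\<close>
  define \<rho> where "\<rho> = min (min \<rho>1 \<rho>2) (min \<rho>3 \<delta>)"
  have \<rho>: "0 < \<rho>" using \<rho>1 \<rho>2 \<rho>3 L by (simp add: \<rho>_def)

  \<comment> \<open>The square root carries the previous value of \<open>E\<close>, since the second
    case compares \<open>E k\<close> with \<open>E (k - 1)\<close>. At \<open>k = 0\<close> the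
    subtraction truncates; the step bound is claimed only for \<open>0 < k\<close>.\<close>
  define \<Psi> where "\<Psi> k = L * \<tau>max * (2 * b / c * \<psi> (E k / 2) + 8 / (pmin * sqrt c) * sqrt (E (k - 1)))" for k
  have ev\<eta>: "\<forall>\<^sub>F k in sequentially. E k < \<eta>" using order_tendstoD(2)[OF E0 \<eta>] .
  \<comment> \<open>This threshold will keep \<open>\<tau> k *\<^sub>R d k\<close> shorter than
    \<open>\<delta>\<close>, where the retraction estimate applies.\<close>
  have ev\<delta>: "\<forall>\<^sub>F k in sequentially. E k < c * (\<delta> / \<tau>max)\<^sup>2"
    using c L \<tau>max by (intro order_tendstoD(2)[OF E0]) simp
  have "(\<lambda>k. \<psi> (E k / 2)) \<longlonglongrightarrow> \<psi> 0"
  proof (rule continuous_on_tendsto_compose[where s = "{0..\<eta>}" and f = \<psi>])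
    show "continuous_on {0..\<eta>} \<psi>" using des by (simp add: desingularization_def)
    show "(\<lambda>k. E k / 2) \<longlonglongrightarrow> 0" using tendsto_divide[OF E0 tendsto_const[of 2]] by simp
    show "\<forall>\<^sub>F k in sequentially. E k / 2 \<in> {0..\<eta>}"
      using ev\<eta>
    proof eventually_elim
      case (elim k)
      then show ?case using Epos[of k] by simp
    qed
  qed (use \<eta> in simp)
  moreover have "\<psi> 0 = 0" using des by (simp add: desingularization_def)
  moreover have "(\<lambda>k. E (k - 1)) \<longlonglongrightarrow> 0" using E0 by (subst filterlim_sequentially_Suc[symmetric]) simp
  ultimately have "\<Psi> \<longlonglongrightarrow> L * \<tau>max * (2 * b / c * 0 + 8 / (pmin * sqrt c) * sqrt 0)"
    unfolding \<Psi>_def by (intro tendsto_intros) auto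
  then have \<Psi>0: "\<Psi> \<longlonglongrightarrow> 0" by simp
  have \<Psi>pos: "\<forall>\<^sub>F k in sequentially. 0 \<le> \<Psi> k"
    using ev\<eta>
  proof eventually_elim
    case (elim k)
    have "0 \<le> \<psi> (E k / 2)" using des Epos[of k] elim by (simp add: desingularization_def)
    then show ?case using L \<tau>max pos c less_imp_le[OF Epos[of "k - 1"]] by (simp add: \<Psi>_def)
  qed
  have step: "\<forall>\<^sub>F k in sequentially. dist (x k) xstar < \<rho> \<longrightarrow> dist (x k) (x (Suc k)) \<le> \<Psi> k - \<Psi> (Suc k)"
    using ev\<eta> ev\<delta> eventually_gt_at_top[of 0]
  proof (eventually_elim, intro impI)
    case (elim k)
    then have k: "E k < \<eta>" "E k < c * (\<delta> / \<tau>max)\<^sup>2" "0 < k" by auto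
    assume "dist (x k) xstar < \<rho>"
    then have near: "x k \<in> V" "x k \<in> V'" "x k \<in> U" "dist (x k) xstar < \<delta>"
      using xM[of k] \<rho>1 \<rho>2 \<rho>3 by (auto simp: \<rho>_def dist_commute)
    have "a * (norm (d k))\<^sup>2 \<le> - (w k \<bullet> d k)" using it(4)[of k] by simp
    also have "\<dots> \<le> norm (w k) * norm (d k)" using Cauchy_Schwarz_ineq2[of "w k" "d k"] by linarith
    also have "\<dots> \<le> B * norm (d k)" using B(2)[OF near(2) it(1)] by (rule mult_right_mono) simp
    finally have "norm (d k) \<le> D"
      using it(3)[of k] pos by (simp add: D_def power2_eq_square pos_le_divide_eq mult.commute)
    note dD = this
    obtain t j where t: "\<tau>min \<le> t" "\<tau> k = \<beta> ^ j * t"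
        "\<forall>i<j. \<not> sufficient_decrease R \<phi> \<sigma> (\<R> k) (x k) (w k) (d k) (\<beta> ^ i * t)"
      using bt by blast
    have "\<tau>low \<le> \<tau> k"
      unfolding \<tau>low_def
      by (rule backtracking_stepsize_lower_bound[OF pos(3,4,5,9) \<kappa> D t(1) pos(1) t(2,3) dec(4) it(4) dD])
        (intro descent near it subspace_scale[OF sub])
    then have "c * (norm (d k))\<^sup>2 \<le> pmin * \<sigma> * a * \<tau> k * (norm (d k))\<^sup>2"
      unfolding c_def using pos by (intro mult_right_mono mult_left_mono) auto
    then have cd: "c * (norm (d k))\<^sup>2 \<le> E k - E (Suc k)" using dec(3)[of k] by (simp add: E_def)
    have f\<eta>: "\<phi> (x k) - \<phi> xstar < \<eta>" using k(1) dec(4)[of k] by (simp add: E_def)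
    have "norm (d k) \<le> 2 * b / c * (\<psi> (E k / 2) - \<psi> (E (Suc k) / 2)) +
        8 / (pmin * sqrt c) * (sqrt (E (k - 1)) - sqrt (E k))"
    proof (rule nonmonotone_KL_step[OF des, where f = "\<phi> (x k) - \<phi> xstar"])
      show "E k \<le> E (k - 1)" using decR[of "k - 1"] k(3) by (simp add: E_def)
      show "\<phi> (x k) - \<phi> xstar \<le> E k" using dec(4)[of k] by (simp add: E_def)
      show "pmin * (E k - (\<phi> (x k) - \<phi> xstar)) \<le> E (k - 1) - E k"
        using dec(5)[of "k - 1"] k(3) by (simp add: E_def)
      \<comment> \<open>Iterates may also fall to or below the level \<open>\<phi> xstar\<close>.
        Then \<open>f < E k / 2\<close>, and the square root term alone bounds the step.\<close>
      assume f: "0 < \<phi> (x k) - \<phi> xstar"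
      have \<psi>': "0 < \<psi>' (\<phi> (x k) - \<phi> xstar)" using des f f\<eta> by (simp add: desingularization_def)
      have "1 \<le> \<psi>' (\<phi> (x k) - \<phi> xstar) * norm (w k)"
      proof (rule KL_inequality_at_subgradient[OF _ \<psi>'])
        show "1 \<le> ereal (\<psi>' (\<phi> (x k) - \<phi> xstar)) *
            ext_dist 0 (limiting_subdiff (extended_fun M \<phi>) (x k))"
          using KL[OF near(3)] f f\<eta> xM xstar by (simp add: extended_fun_def indicator_fun_def)
        show "w k \<in> limiting_subdiff (extended_fun M \<phi>) (x k)"
          using proj_subdiff_subset_limiting_subdiff[OF M xM] it(1) by blast
      qed
      also have "\<dots> \<le> \<psi>' (\<phi> (x k) - \<phi> xstar) * (b * norm (d k))"
        using \<psi>' it(5) by (intro mult_left_mono) auto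
      finally show "1 \<le> \<psi>' (\<phi> (x k) - \<phi> xstar) * (b * norm (d k))" .
    qed (use cd k pos c Epos in \<open>auto intro: less_imp_le\<close>)
    note len = this
    have "c * (norm (d k))\<^sup>2 < c * (\<delta> / \<tau>max)\<^sup>2" using cd k(2) Epos[of "Suc k"] by linarith
    then have "norm (d k) < \<delta> / \<tau>max"
      using c L \<tau>max by (simp add: power2_less_imp_less)
    then have "norm (d k) * \<tau>max < \<delta>" using \<tau>max by (simp add: pos_less_divide_eq)
    moreover have \<tau>d: "norm (\<tau> k *\<^sub>R d k) \<le> \<tau>max * norm (d k)"
      using dec(1,2)[of k] by (simp add: mult_right_mono)
    ultimately have "dist (x k) (x (Suc k)) \<le> L * norm (\<tau> k *\<^sub>R d k)"
      unfolding it(6) by (intro Lip xM near it subspace_scale[OF sub]) (simp add: mult.commute)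
    also have "\<dots> \<le> L * (\<tau>max * norm (d k))" using \<tau>d L by (intro mult_left_mono) auto
    also have "\<dots> \<le> L * \<tau>max * (2 * b / c * (\<psi> (E k / 2) - \<psi> (E (Suc k) / 2)) +
        8 / (pmin * sqrt c) * (sqrt (E (k - 1)) - sqrt (E k)))"
      using mult_left_mono[OF len, of "L * \<tau>max"] L \<tau>max by (simp add: mult.assoc)
    also have "\<dots> = \<Psi> k - \<Psi> (Suc k)" by (simp add: \<Psi>_def algebra_simps diff_divide_distrib)
    finally show "dist (x k) (x (Suc k)) \<le> \<Psi> k - \<Psi> (Suc k)" .
  qed
  show ?thesis by (rule subsequence_trap[OF s \<Psi>0 \<Psi>pos \<rho> step])
qed

end
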